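(* Let $\mathcal{A}$ be a nonnegative irreducible tensor of order $m$ and dimension $n$, and let $r$ be the number of weakly connected components of the solid graph $G^s(\mathcal{A})$. Then for any $D\in\mathfrak{D}^{(0)}(\mathcal{A})$, $D^{(m-1)^r}=I$, the identity matrix; and the stabilizing index satisfies $s(\mathcal{A})\le (m-1)^{r(n-1)}$.
   Context: Let $m\ge 2$, $n\ge 1$, $[n]=\{1,\dots,n\}$. A tensor of order $m$ and dimension $n$ is an array $\mathcal{A}=(a_{i_1i_2\ldots i_m})$ of complex numbers indexed by $i_1,\dots,i_m\in[n]$; it is nonnegative if all its entries are nonnegative reals. $\mathcal{A}$ is reducible if there is a nonempty proper subset $I\subset[n]$ such that $a_{i_1i_2\ldots i_m}=0$ for all $i_1\in I$ and all $i_2,\dots,i_m\notin I$; otherwise it is irreducible. For an invertible diagonal $n\times n$ complex matrix $D=\mathrm{diag}(d_{11},\dots,d_{nn})$, the tensor $D^{-(m-1)}\mathcal{A}D$ has entries $d_{i_1i_1}^{-(m-1)}a_{i_1i_2\ldots i_m}d_{i_2i_2}\cdots d_{i_mi_m}$. Define $\mathfrak{D}^{(0)}(\mathcal{A})=\{D: \mathcal{A}=D^{-(m-1)}\mathcal{A}D,\ d_{11}=1\}$, where $D$ ranges over invertible diagonal $n\times n$ complex matrices. The stabilizing index $s(\mathcal{A})$ is the cardinality of $\mathfrak{D}^{(0)}(\mathcal{A})$. The solid graph $G^s(\mathcal{A})$ is the directed graph on vertex set $[n]$ in which $(i,j)$ is an arc if and only if $a_{ij\ldots j}\ne 0$. Its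 weakly connected components are the connected components of the undirected graph obtained by ignoring the directions of the arcs. *)

theory Defs
  imports
    Complex_Main
    "HOL-Library.FuncSet"
    "HOL-Library.Extended_Nat"
    "HOL-Library.Nonpos_Ints"
    "Jordan_Normal_Form.Matrix"
    "Graph_Theory.Digraph_Component"
begin

text \<open>
  Indices are zero-based, as for the matrices of \<^theory>\<open>Jordan_Normal_Form.Matrix\<close>: the index set
  \<open>{1, \<dots>, n}\<close> becomes \<open>{0..<n}\<close>. A multi-index \<open>(i\<^sub>1, \<dots>, i\<^sub>m)\<close> is a list of length \<open>m\<close>, with \<open>i\<^sub>1\<close> its
  head and \<open>(i\<^sub>2, \<dots>, i\<^sub>m)\<close> its tail. Tensors are extensional functions on the multi-indices, so that
  equality of tensors is equality of all entries.
\<close>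

definition multi_indices :: "nat \<Rightarrow> nat \<Rightarrow> nat list set" where
  "multi_indices m n = {ix. length ix = m \<and> set ix \<subseteq> {0..<n}}"

definition tensors :: "nat \<Rightarrow> nat \<Rightarrow> (nat list \<Rightarrow> complex) set" where
  "tensors m n = multi_indices m n \<rightarrow>\<^sub>E UNIV"

definition nonneg_tensor :: "nat \<Rightarrow> nat \<Rightarrow> (nat list \<Rightarrow> complex) \<Rightarrow> bool" where
  "nonneg_tensor m n A \<longleftrightarrow> (\<forall>ix \<in> multi_indices m n. A ix \<in> \<real>\<^sub>\<ge>\<^sub>0)"

definition reducible_tensor :: "nat \<Rightarrow> nat \<Rightarrow> (nat list \<Rightarrow> complex) \<Rightarrow> bool" where
  "reducible_tensor m n A \<longleftrightarrow>
     (\<exists>I. I \<noteq> {} \<and> I \<subset> {0..<n} \<and>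
          (\<forall>ix \<in> multi_indices m n. hd ix \<in> I \<and> set (tl ix) \<inter> I = {} \<longrightarrow> A ix = 0))"

abbreviation irreducible_tensor :: "nat \<Rightarrow> nat \<Rightarrow> (nat list \<Rightarrow> complex) \<Rightarrow> bool" where
  "irreducible_tensor m n A \<equiv> \<not> reducible_tensor m n A"

text \<open>The tensor \<open>D\<^bsup>-(m-1)\<^esup> A D\<close>.\<close>

definition diag_transform ::
  "nat \<Rightarrow> nat \<Rightarrow> complex mat \<Rightarrow> (nat list \<Rightarrow> complex) \<Rightarrow> nat list \<Rightarrow> complex" where
  "diag_transform m n D A =
     (\<lambda>ix \<in> multi_indices m n.
        (D $$ (hd ix, hd ix)) powi (- int (m - 1)) * A ix * (\<Prod>j \<leftarrow> tl ix. D $$ (j, j)))"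

text \<open>The set \<open>\<DD>\<^bsup>(0)\<^esup>(A)\<close>; its normalization \<open>d\<^sub>1\<^sub>1 = 1\<close> concerns the entry at position \<open>(0, 0)\<close>.\<close>

definition stabilizing_matrices ::
  "nat \<Rightarrow> nat \<Rightarrow> (nat list \<Rightarrow> complex) \<Rightarrow> complex mat set" where
  "stabilizing_matrices m n A =
     {D \<in> carrier_mat n n. diagonal_mat D \<and> invertible_mat D \<and>
        A = diag_transform m n D A \<and> D $$ (0, 0) = 1}"

text \<open>
  The cardinality is taken in \<^typ>\<open>enat\<close>, because \<^const>\<open>card\<close> is 0 on infinite sets: a finite
  upper bound on the stabilizing index includes finiteness of the set.
\<close>

definition stabilizing_index :: "nat \<Rightarrow> nat \<Rightarrow> (nat list \<Rightarrow> complex) \<Rightarrow> enat" where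
  "stabilizing_index m n A =
     (if finite (stabilizing_matrices m n A) then enat (card (stabilizing_matrices m n A)) else \<infinity>)"

definition solid_graph :: "nat \<Rightarrow> nat \<Rightarrow> (nat list \<Rightarrow> complex) \<Rightarrow> nat pair_pre_digraph" where
  "solid_graph m n A =
     \<lparr>pverts = {0..<n},
      parcs = {(i, j). i \<in> {0..<n} \<and> j \<in> {0..<n} \<and> A (i # replicate (m - 1) j) \<noteq> 0}\<rparr>"

text \<open>
  Components are represented by their vertex sets. The Graph_Theory library models undirected
  graphs as symmetric digraphs, whose connected components are the strongly connected ones.
\<close>

definition weak_components :: "('a, 'b) pre_digraph \<Rightarrow> 'a set set" where
  "weak_components G = pre_digraph.sccs_verts (with_proj (mk_symmetric G))"

end

theory Submission
  imports Defs
begin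

text \<open>
  Let \<open>d\<close> be the diagonal of a stabilizing matrix. Invariance of the tensor says that
  \<open>d\<^sub>i ^ (m - 1)\<close> is the product of \<open>d\<^sub>j\<^sub>2, \<dots>, d\<^sub>j\<^sub>m\<close> for every nonzero entry
  \<open>a\<^sub>i\<^sub>j\<^sub>2\<dots>\<^sub>j\<^sub>m\<close>; such a weight is called balanced below, and powers of balanced weights are
  balanced. The proof counts the number of distinct values of \<open>d\<close>, \<open>d ^ (m - 1)\<close>,
  \<open>d ^ ((m - 1) ^ 2)\<close>, and so on.

  An arc \<open>(i, j)\<close> of the solid graph is a nonzero entry \<open>a\<^sub>i\<^sub>j\<dots>\<^sub>j\<close>, so it forces
  \<open>d\<^sub>i ^ (m - 1) = d\<^sub>j ^ (m - 1)\<close>. Hence \<open>d ^ (m - 1)\<close> is constant on the weakly connected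
  components and takes at most \<open>r\<close> values (\<open>card_image_le_card_weak_components\<close>). From then on
  irreducibility makes the number of values drop at every further step until it is one
  (\<open>card_power_image_less\<close>): if a balanced weight \<open>e\<close> is not constant, the complement of a level
  set \<open>{e = v}\<close> is a nonempty proper subset, so some nonzero entry has its first index outside
  the level set and all others inside. It gives \<open>e\<^sub>i ^ (m - 1) = v ^ (m - 1)\<close> with
  \<open>e\<^sub>i \<noteq> v\<close>, so two values merge. After \<open>r - 1\<close> such steps, \<open>d ^ (m - 1) ^ r\<close> is constant,
  and its value is 1 by the normalization.

  The bound on the stabilizing index follows: a stabilizing matrix is determined by its
  \<open>n - 1\<close> diagonal entries outside position \<open>(0, 0)\<close>, all of which are roots of unity of order
  dividing \<open>(m - 1) ^ r\<close>.
\<close>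

section \<open>Functions that are constant along the arcs of a digraph\<close>

lemma (in wf_digraph) constant_on_reachable:
  assumes "u \<rightarrow>\<^sup>* v" and "\<And>u v. u \<rightarrow> v \<Longrightarrow> f u = f v"
  shows "f u = f v"
  using assms(1) by (induction rule: reachable_induct) (auto simp: assms(2))

text \<open>
  Such a function factors through the partition into weak components.
\<close>

lemma card_image_le_card_weak_components:
  assumes "fin_digraph G"
    and const: "\<And>e. e \<in> arcs G \<Longrightarrow> f (tail G e) = f (head G e)"
  shows "card (f ` verts G) \<le> card (weak_components G)"
proof -
  interpret G: fin_digraph G by fact
  interpret S: pair_fin_digraph "mk_symmetric G" by (rule G.pair_fin_digraph_mk_symmetric)
  define g where "g C = f (SOME v. v \<in> C)" for C
  have adj: "f u = f v" if "(u, v) \<in> parcs (mk_symmetric G)" for u v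
    using that const by (auto simp: parcs_mk_symmetric)
  have "f v = g (S.scc_of v)" if "v \<in> verts G" for v
  proof -
    have "v \<in> S.scc_of v" using that by (simp add: S.in_scc_of_self)
    then have "(SOME u. u \<in> S.scc_of v) \<in> S.scc_of v" by (rule someI)
    then have "v \<rightarrow>\<^sup>*\<^bsub>with_proj (mk_symmetric G)\<^esub> (SOME u. u \<in> S.scc_of v)"
      by (simp add: S.scc_of_def)
    then show ?thesis unfolding g_def using adj by (rule S.constant_on_reachable[where f = f])
  qed
  then have "f ` verts G \<subseteq> g ` weak_components G"
    by (auto simp: weak_components_def S.sccs_verts_conv_scc_of)
  moreover have "finite (weak_components G)"
    unfolding weak_components_def by (rule S.finite_sccs_verts)
  ultimately show ?thesis by (rule surj_card_le[rotated])
qed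

lemma fin_digraph_solid_graph: "fin_digraph (with_proj (solid_graph m n A))"
proof -
  have "parcs (solid_graph m n A) \<subseteq> {0..<n} \<times> {0..<n}"
    by (auto simp: solid_graph_def)
  then have "finite (parcs (solid_graph m n A))" by (rule finite_subset) simp
  then show ?thesis by unfold_locales (auto simp: solid_graph_def)
qed

section \<open>Balanced weights\<close>

definition balanced :: "nat \<Rightarrow> nat \<Rightarrow> (nat list \<Rightarrow> complex) \<Rightarrow> (nat \<Rightarrow> 'a::comm_monoid_mult) \<Rightarrow> bool"
  where "balanced m n A d \<longleftrightarrow>
    (\<forall>ix \<in> multi_indices m n. A ix \<noteq> 0 \<longrightarrow> d (hd ix) ^ (m - 1) = (\<Prod>j \<leftarrow> tl ix. d j))"

lemma prod_list_const:
  fixes e :: "'b \<Rightarrow> 'a::comm_monoid_mult"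
  assumes "\<And>x. x \<in> set xs \<Longrightarrow> e x = v"
  shows "(\<Prod>x \<leftarrow> xs. e x) = v ^ length xs"
  using assms by (induction xs) auto

lemma prod_list_map_power:
  fixes e :: "'b \<Rightarrow> 'a::comm_monoid_mult"
  shows "(\<Prod>x \<leftarrow> xs. e x ^ k) = (\<Prod>x \<leftarrow> xs. e x) ^ k"
  by (induction xs) (auto simp: power_mult_distrib)

lemma balanced_power:
  assumes "balanced m n A d"
  shows "balanced m n A (\<lambda>i. d i ^ k)"
  unfolding balanced_def prod_list_map_power
proof (intro ballI impI)
  fix ix assume "ix \<in> multi_indices m n" "A ix \<noteq> 0"
  then have "(\<Prod>j \<leftarrow> tl ix. d j) ^ k = (d (hd ix) ^ (m - 1)) ^ k"
    using assms by (simp add: balanced_def)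
  also have "\<dots> = (d (hd ix) ^ k) ^ (m - 1)"
    by (metis power_mult mult.commute)
  finally show "(d (hd ix) ^ k) ^ (m - 1) = (\<Prod>j \<leftarrow> tl ix. d j) ^ k" by simp
qed

lemma balanced_solid_arc:
  assumes "balanced m n A d" and "m \<ge> 2" and "(i, j) \<in> parcs (solid_graph m n A)"
  shows "d i ^ (m - 1) = d j ^ (m - 1)"
proof -
  have "i # replicate (m - 1) j \<in> multi_indices m n"
    using assms(2,3) by (auto simp: multi_indices_def solid_graph_def)
  then show ?thesis
    using assms(1,3) by (fastforce simp: balanced_def solid_graph_def prod_list_const)
qed

text \<open>
  Irreducibility, applied to the complement of a level set, makes raising to the power
  \<open>m - 1\<close> identify the value of that level set with another one.
\<close>

lemma card_power_image_less:
  assumes "balanced m n A e" and "irreducible_tensor m n A" and "card (e ` {0..<n}) > 1"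
  shows "card ((\<lambda>i. e i ^ (m - 1)) ` {0..<n}) < card (e ` {0..<n})"
proof -
  obtain k l where kl: "k < n" "l < n" "e k \<noteq> e l"
  proof -
    have "\<not> (\<forall>a \<in> e ` {0..<n}. \<forall>b \<in> e ` {0..<n}. a = b)"
      using assms(3) by (subst card_le_Suc0_iff_eq[symmetric]) auto
    then show ?thesis using that by auto
  qed
  define I where "I = {i \<in> {0..<n}. e i \<noteq> e k}"
  have "l \<in> I" "k \<in> {0..<n} - I" "I \<subseteq> {0..<n}" using kl by (auto simp: I_def)
  then have "I \<noteq> {}" "I \<subset> {0..<n}" by blast+
  then obtain ix where ix: "ix \<in> multi_indices m n" "hd ix \<in> I" "set (tl ix) \<inter> I = {}" "A ix \<noteq> 0"
    using assms(2) unfolding reducible_tensor_def by metis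
  have "set (tl ix) \<subseteq> {0..<n}"
    using ix(1) by (cases ix) (auto simp: multi_indices_def)
  then have "(\<Prod>j \<leftarrow> tl ix. e j) = e k ^ length (tl ix)"
    using ix(3) by (intro prod_list_const) (unfold I_def, blast)
  then have eq: "e (hd ix) ^ (m - 1) = e k ^ (m - 1)"
    using assms(1) ix(1,4) by (simp add: balanced_def multi_indices_def)
  let ?p = "\<lambda>x. x ^ (m - 1)"
  have "\<not> inj_on ?p (e ` {0..<n})"
    using eq ix(2) kl(1) inj_onD[of ?p "e ` {0..<n}" "e (hd ix)" "e k"] by (auto simp: I_def)
  then have "card (?p ` e ` {0..<n}) \<noteq> card (e ` {0..<n})"
    using eq_card_imp_inj_on by blast
  then show ?thesis
    using card_image_le[of "e ` {0..<n}" ?p] by (simp add: image_image)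
qed

text \<open>
  Each further power merges values until at most one is left, whence the truncation at 1.
\<close>

lemma card_iterated_power_image_le:
  assumes "balanced m n A d" and "irreducible_tensor m n A"
    and "card ((\<lambda>i. d i ^ (m - 1)) ` {0..<n}) \<le> r"
  shows "card ((\<lambda>i. d i ^ (m - 1) ^ Suc k) ` {0..<n}) \<le> max 1 (r - k)"
proof (induction k)
  case 0
  then show ?case using assms(3) by simp
next
  case (Suc k)
  let ?e = "\<lambda>i. d i ^ (m - 1) ^ Suc k"
  have pow: "?e i ^ (m - 1) = d i ^ (m - 1) ^ Suc (Suc k)" for i
    by (simp add: mult.commute mult.left_commute flip: power_mult)
  show ?case
  proof (cases "card (?e ` {0..<n}) > 1")
    case True
    have "card ((\<lambda>i. ?e i ^ (m - 1)) ` {0..<n}) < card (?e ` {0..<n})"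
      using balanced_power[OF assms(1)] assms(2) True by (rule card_power_image_less)
    then show ?thesis unfolding pow using Suc by linarith
  next
    case False
    have "card ((\<lambda>x. x ^ (m - 1)) ` ?e ` {0..<n}) \<le> card (?e ` {0..<n})"
      by (rule card_image_le) simp
    then show ?thesis unfolding image_image pow using False by linarith
  qed
qed

lemma balanced_power_eq_1:
  assumes bal: "balanced m n A d" and irr: "irreducible_tensor m n A" and "m \<ge> 2"
    and "d 0 = 1" and "i < n"
  shows "d i ^ (m - 1) ^ card (weak_components (with_proj (solid_graph m n A))) = 1"
proof -
  define r where "r = card (weak_components (with_proj (solid_graph m n A)))"
  have verts: "verts (with_proj (solid_graph m n A)) = {0..<n}"
    by (simp add: solid_graph_def)
  have le: "card ((\<lambda>i. d i ^ (m - 1)) ` {0..<n}) \<le> r"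
    unfolding r_def verts[symmetric]
    by (rule card_image_le_card_weak_components[OF fin_digraph_solid_graph])
      (use balanced_solid_arc[OF bal \<open>m \<ge> 2\<close>] in auto)
  have "card ((\<lambda>i. d i ^ (m - 1)) ` {0..<n}) > 0"
    using \<open>i < n\<close> by (auto simp: card_gt_0_iff)
  with le have "r > 0" by simp
  \<comment> \<open>One step is spent on passing to components, so \<open>r - 1\<close> merging steps remain.\<close>
  let ?f = "\<lambda>i. d i ^ (m - 1) ^ r"
  have "card (?f ` {0..<n}) \<le> 1"
    using card_iterated_power_image_le[OF bal irr le, of "r - 1"] \<open>r > 0\<close> by simp
  moreover have "?f i \<in> ?f ` {0..<n}" "?f 0 \<in> ?f ` {0..<n}" using \<open>i < n\<close> by auto
  ultimately have "?f i = ?f 0"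
    by (intro card_le_Suc0_iff_eq[THEN iffD1, rule_format, of "?f ` {0..<n}"]) auto
  then show ?thesis using \<open>d 0 = 1\<close> by (simp add: r_def)
qed

section \<open>Stabilizing matrices\<close>

lemma stabilizing_matricesD:
  assumes "D \<in> stabilizing_matrices m n A"
  shows "D \<in> carrier_mat n n" "diagonal_mat D" "D $$ (0, 0) = 1" "A = diag_transform m n D A"
  using assms by (simp_all only: stabilizing_matrices_def mem_Collect_eq)

text \<open>
  Write \<open>d\<close> for the diagonal entry at the first index of a nonzero entry and \<open>q\<close> for the product
  over the other indices. Cancelling the nonzero entry leaves \<open>inverse (d ^ (m - 1)) * q = 1\<close>,
  which also excludes \<open>d ^ (m - 1) = 0\<close>, because the inverse of 0 is 0.
\<close>

lemma stabilizing_matrix_balanced: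
  assumes "D \<in> stabilizing_matrices m n A"
  shows "balanced m n A (\<lambda>i. D $$ (i, i))"
  unfolding balanced_def
proof (intro ballI impI)
  fix ix assume ix: "ix \<in> multi_indices m n" "A ix \<noteq> 0"
  let ?d = "D $$ (hd ix, hd ix)" and ?q = "\<Prod>j \<leftarrow> tl ix. D $$ (j, j)"
  have "A ix = diag_transform m n D A ix"
    by (rule fun_cong[OF stabilizing_matricesD(4)[OF assms(1)]])
  then have "A ix = inverse (?d ^ (m - 1)) * A ix * ?q"
    using ix(1) by (simp add: diag_transform_def power_int_minus)
  then have "A ix * (inverse (?d ^ (m - 1)) * ?q) = A ix * 1" by (simp add: algebra_simps)
  then have "inverse (?d ^ (m - 1)) * ?q = 1"
    using ix(2) by (metis mult_left_cancel)
  then show "?d ^ (m - 1) = ?q"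
    by (metis inverse_inverse_eq inverse_unique)
qed

lemma diagonal_mat_power:
  fixes D :: "'a::comm_semiring_1 mat"
  assumes "D \<in> carrier_mat n n" and "diagonal_mat D"
  shows "D ^\<^sub>m k = mat n n (\<lambda>(i, j). if i = j then D $$ (i, i) ^ k else 0)"
proof (induction k)
  case 0
  then show ?case using assms(1) by (auto intro!: eq_matI)
next
  case (Suc k)
  show ?case
  proof (rule eq_matI)
    fix i j assume ij: "i < dim_row (mat n n (\<lambda>(i, j). if i = j then D $$ (i, i) ^ Suc k else 0))"
      "j < dim_col (mat n n (\<lambda>(i, j). if i = j then D $$ (i, i) ^ Suc k else 0))"
    have "(D ^\<^sub>m Suc k) $$ (i, j) =
        (\<Sum>l = 0..<n. (if i = l then D $$ (i, i) ^ k else 0) * D $$ (l, j))"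
      using ij assms(1) by (auto simp: Suc scalar_prod_def intro!: sum.cong)
    also have "\<dots> = (\<Sum>l = 0..<n. if i = l then D $$ (i, i) ^ k * D $$ (i, j) else 0)"
      by (intro sum.cong) auto
    also have "\<dots> = D $$ (i, i) ^ k * D $$ (i, j)" using ij by simp
    also have "\<dots> = (if i = j then D $$ (i, i) ^ Suc k else 0)"
      using ij assms by (auto simp: diagonal_mat_def mult.commute)
    finally show "(D ^\<^sub>m Suc k) $$ (i, j) =
        mat n n (\<lambda>(i, j). if i = j then D $$ (i, i) ^ Suc k else 0) $$ (i, j)"
      using ij by simp
  qed (use assms(1) in auto)
qed

lemma stabilizing_matrices_diag_inj:
  "inj_on (\<lambda>D. \<lambda>i \<in> {1..<n}. D $$ (i, i)) (stabilizing_matrices m n A)"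
proof (rule inj_onI)
  fix D E
  assume D: "D \<in> stabilizing_matrices m n A" and E: "E \<in> stabilizing_matrices m n A"
    and eq: "(\<lambda>i \<in> {1..<n}. D $$ (i, i)) = (\<lambda>i \<in> {1..<n}. E $$ (i, i))"
  note D' = stabilizing_matricesD(1,2)[OF D] and E' = stabilizing_matricesD(1,2)[OF E]
  have diag: "D $$ (i, i) = E $$ (i, i)" if "i < n" for i
  proof (cases "i = 0")
    case True
    then show ?thesis using stabilizing_matricesD(3)[OF D] stabilizing_matricesD(3)[OF E] by simp
  next
    case False
    then show ?thesis using fun_cong[OF eq, of i] that by simp
  qed
  show "D = E"
  proof (rule eq_matI)
    fix i j assume "i < dim_row E" "j < dim_col E"
    then show "D $$ (i, j) = E $$ (i, j)"
      using D' E' diag by (cases "i = j") (auto simp: diagonal_mat_def)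
  qed (use D' E' in auto)
qed

text \<open>
  The position \<open>(0, 0)\<close> is fixed by the normalization, which leaves \<open>n - 1\<close> free diagonal entries.
\<close>

lemma stabilizing_index_le:
  assumes "N \<ge> 1"
    and roots: "\<And>D i. D \<in> stabilizing_matrices m n A \<Longrightarrow> i < n \<Longrightarrow> D $$ (i, i) ^ N = 1"
  shows "stabilizing_index m n A \<le> enat (N ^ (n - 1))"
proof -
  let ?S = "stabilizing_matrices m n A" and ?U = "{z::complex. z ^ N = 1}"
  let ?h = "\<lambda>D::complex mat. \<lambda>i \<in> {1..<n}. D $$ (i, i)"
  have U: "finite ?U" "card ?U \<le> N"
    using assms(1) by (auto intro: finite_roots_unity card_roots_unity)
  have sub: "?h ` ?S \<subseteq> {1..<n} \<rightarrow>\<^sub>E ?U" using roots by auto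
  have fin: "finite ({1..<n} \<rightarrow>\<^sub>E ?U)" using U by (intro finite_PiE) auto
  have "finite ?S"
    using inj_on_finite[OF stabilizing_matrices_diag_inj sub fin] .
  moreover have "card ?S \<le> card ({1..<n} \<rightarrow>\<^sub>E ?U)"
    using stabilizing_matrices_diag_inj sub fin by (rule card_inj_on_le)
  moreover have "card ({1..<n} \<rightarrow>\<^sub>E ?U) \<le> N ^ (n - 1)"
    using U by (simp add: card_PiE power_mono)
  ultimately show ?thesis by (simp add: stabilizing_index_def)
qed

theorem corollary4p7:
  fixes m n r :: nat and A :: "nat list \<Rightarrow> complex"
  assumes "m \<ge> 2" and "n \<ge> 1"
    and "A \<in> tensors m n"
    and "nonneg_tensor m n A"
    and "irreducible_tensor m n A"
    and "r = card (weak_components (with_proj (solid_graph m n A)))"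
  shows "(\<forall>D \<in> stabilizing_matrices m n A. D ^\<^sub>m ((m - 1) ^ r) = 1\<^sub>m n)
    \<and> stabilizing_index m n A \<le> enat ((m - 1) ^ (r * (n - 1)))"
proof -
  have roots: "D $$ (i, i) ^ (m - 1) ^ r = 1"
    if "D \<in> stabilizing_matrices m n A" "i < n" for D i
    unfolding assms(6)
    using stabilizing_matrix_balanced[OF that(1)] assms(5,1)
      stabilizing_matricesD(3)[OF that(1)] that(2)
    by (rule balanced_power_eq_1)
  have "D ^\<^sub>m ((m - 1) ^ r) = 1\<^sub>m n" if D: "D \<in> stabilizing_matrices m n A" for D
    unfolding diagonal_mat_power[OF stabilizing_matricesD(1,2)[OF D]]
    using roots[OF D] by (intro eq_matI) auto
  moreover have "stabilizing_index m n A \<le> enat (((m - 1) ^ r) ^ (n - 1))"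
    using assms(1) roots by (intro stabilizing_index_le) auto
  ultimately show ?thesis by (simp add: power_mult)
qed

end
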